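(* For all $n\geq 1$, $c_n(22\text{-}1)=L_n$ and $c_n(32\text{-}1)=\frac{1}{2}\left(3^{n-1}+1\right)$.
   Context: A Catalan word of length $n\ge 1$ is a sequence $\pi=\pi_1\cdots\pi_n$ of positive integers with $\pi_1=1$ and $\pi_{i+1}\le \pi_i+1$ for $1\le i\le n-1$; $\mathcal{C}_n$ is the set of these. Two sequences of the same length are order-isomorphic if their corresponding pairs of entries stand in the same relation ($<$, $>$ or $=$). A word $\pi$ contains the vincular pattern $xy\text{-}z$ if there are indices $i,j$ with $i+1<j\le n$ such that $\pi_i\pi_{i+1}\pi_j$ is order-isomorphic to $xyz$ (the first two letters must be adjacent in $\pi$); otherwise $\pi$ avoids it. $c_n(\tau)$ denotes the number of members of $\mathcal{C}_n$ avoiding $\tau$. $L_n$ (OEIS A005773; $L_1=1$, $L_2=2$, $L_3=5$, $L_4=13,\ldots$) is, for $n\ge1$, the number of lattice paths from $(0,0)$ to the line $x=n-1$ using steps $(1,1)$, $(1,-1)$, $(1,0)$ that never go below the $x$-axis (Motzkin left-factors with $n-1$ steps). *)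

theory Defs
  imports Complex_Main
begin

text \<open>Words are lists of natural numbers, so positions are counted from 0.\<close>

definition catalan_words :: "nat \<Rightarrow> nat list set" where
  "catalan_words n = {w. length w = n \<and> n \<ge> 1 \<and> (\<forall>i<n. w ! i \<ge> 1) \<and> w ! 0 = 1 \<and>
     (\<forall>i. Suc i < n \<longrightarrow> w ! Suc i \<le> w ! i + 1)}"

definition order_isomorphic :: "nat list \<Rightarrow> nat list \<Rightarrow> bool" where
  "order_isomorphic u v \<longleftrightarrow> length u = length v \<and>
     (\<forall>i<length u. \<forall>j<length u.
        (u ! i < u ! j \<longleftrightarrow> v ! i < v ! j) \<and>
        (u ! i > u ! j \<longleftrightarrow> v ! i > v ! j) \<and>
        (u ! i = u ! j \<longleftrightarrow> v ! i = v ! j))"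

text \<open>The arguments \<open>x y z\<close> stand for the vincular pattern \<open>xy-z\<close>: the letters matching
  \<open>x\<close> and \<open>y\<close> are adjacent, the one matching \<open>z\<close> is anywhere to their right.\<close>

definition contains_vincular :: "nat \<Rightarrow> nat \<Rightarrow> nat \<Rightarrow> nat list \<Rightarrow> bool" where
  "contains_vincular x y z w \<longleftrightarrow>
     (\<exists>i j. i + 1 < j \<and> j < length w \<and>
        order_isomorphic [w ! i, w ! (i + 1), w ! j] [x, y, z])"

definition avoiders :: "nat \<Rightarrow> nat \<Rightarrow> nat \<Rightarrow> nat \<Rightarrow> nat list set" where
  "avoiders x y z n = {w \<in> catalan_words n. \<not> contains_vincular x y z w}"

definition num_avoiders :: "nat \<Rightarrow> nat \<Rightarrow> nat \<Rightarrow> nat \<Rightarrow> nat" where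
  "num_avoiders x y z n = card (avoiders x y z n)"

text \<open>A lattice path starting at the origin is represented by its list of steps; the point
  reached after \<open>k\<close> steps is the sum of the first \<open>k\<close> of them.\<close>

definition path_point :: "(int \<times> int) list \<Rightarrow> nat \<Rightarrow> int \<times> int" where
  "path_point s k = (sum_list (map fst (take k s)), sum_list (map snd (take k s)))"

definition motzkin_left_factors :: "nat \<Rightarrow> (int \<times> int) list set" where
  "motzkin_left_factors n = {s. set s \<subseteq> {(1, 1), (1, -1), (1, 0)} \<and>
     fst (path_point s (length s)) = int n - 1 \<and>
     (\<forall>k\<le>length s. snd (path_point s k) \<ge> 0)}"

definition L :: "nat \<Rightarrow> nat" where
  "L n = card (motzkin_left_factors n)"

end

theory Submission
  imports Defs
begin

text \<open>
  Both patterns say the same kind of thing: some adjacent pair of letters \<open>x y\<close> in a relation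
  \<open>R\<close> (equality for \<open>22-1\<close>, a descent for \<open>32-1\<close>) is followed later by a letter below \<open>y\<close>.
  To avoid the pattern is therefore to respect a floor: each occurrence of an \<open>R\<close>-pair raises the
  floor to \<open>y\<close>, and no later letter may lie below it. When a word is read from left to right, all
  that matters for its continuations is the height \<open>h\<close> of the last letter above the
  current floor. If \<open>f n h\<close> is the number of admissible continuations of length \<open>n\<close>, then
  \<open>f 0 h = 1\<close>, and distinguishing the next letter gives

    \<^item> for \<open>22-1\<close>: \<open>f (n+1) h = f n (h+1) + f n 0 + (f n 0 + \<dots> + f n (h-1))\<close>, because
      repeating the letter lifts the floor to it, so that the new height is 0;
    \<^item> for \<open>32-1\<close>: \<open>f (n+1) h = f n (h+1) + f n h + h * f n 0\<close>, because each of the \<open>h\<close> possible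
      descents lifts the floor to the letter it ends in.

  The number wanted is \<open>f (n-1) 0\<close>. The second recurrence has a solution \<open>a n + b n * h\<close> with
  \<open>a n + b n = 3 ^ n\<close> and \<open>a n - b n = 1\<close>.

  For the first one, let \<open>d n j\<close> be the number of Motzkin paths with \<open>n\<close> steps that start at
  height \<open>j\<close>, stay weakly above the axis and touch it. Sorting the paths from height \<open>h\<close>
  by their lowest point shows that \<open>d n 0 + \<dots> + d n h\<close> of them never go below the axis. On the
  other hand, \<open>f n h\<close> is the binomial transform \<open>\<Sum>j\<le>h. (h choose j) * d n j\<close>: the forward
  difference in \<open>h\<close> of a binomial transform is the transform of the shifted sequence, so that
  the differenced recurrence for \<open>f\<close> becomes the three-term recurrence
  \<open>d (n+1) (j+1) = d n j + d n (j+1) + d n (j+2)\<close>. At \<open>h = 0\<close> both counts are \<open>d n 0\<close>.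
\<close>

section \<open>Floors and continuations\<close>

text \<open>
  Avoidance of \<open>22-1\<close> is the case where \<open>R\<close> is equality, avoidance of \<open>32-1\<close> the case where it is
  \<open>(>)\<close>.
\<close>

fun respects_floors :: "(nat \<Rightarrow> nat \<Rightarrow> bool) \<Rightarrow> nat list \<Rightarrow> bool" where
  "respects_floors R (x # y # w) \<longleftrightarrow>
     (R x y \<longrightarrow> (\<forall>z\<in>set w. y \<le> z)) \<and> respects_floors R (y # w)"
| "respects_floors R w \<longleftrightarrow> True"

lemma respects_floors_iff_nth:
  "respects_floors R w \<longleftrightarrow>
     (\<forall>i j. i + 1 < j \<longrightarrow> j < length w \<longrightarrow> R (w ! i) (w ! (i + 1)) \<longrightarrow> w ! (i + 1) \<le> w ! j)"
proof (induction R w rule: respects_floors.induct)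
  case (1 R x y w)
  let ?P = "\<lambda>w i j. i + 1 < j \<longrightarrow> j < length w \<longrightarrow> R (w ! i) (w ! (i + 1)) \<longrightarrow> w ! (i + 1) \<le> w ! j"
  have all_Suc: "(\<forall>i. Q i) \<longleftrightarrow> Q 0 \<and> (\<forall>i. Q (Suc i))" for Q :: "nat \<Rightarrow> bool"
    using nat.induct[of Q] by blast
  have "(\<forall>i j. ?P (x # y # w) i j) \<longleftrightarrow>
      (\<forall>j. ?P (x # y # w) 0 j) \<and> (\<forall>i j. ?P (x # y # w) (Suc i) j)"
    by (rule all_Suc)
  also have "(\<forall>j. ?P (x # y # w) 0 j) \<longleftrightarrow> (\<forall>j. ?P (x # y # w) 0 (Suc (Suc j)))"
    unfolding all_Suc[of "?P (x # y # w) 0"] all_Suc[of "\<lambda>j. ?P (x # y # w) 0 (Suc j)"] by simp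
  also have "\<dots> \<longleftrightarrow> (R x y \<longrightarrow> (\<forall>z\<in>set w. y \<le> z))"
    by (auto simp: all_set_conv_all_nth)
  also have "(\<forall>i j. ?P (x # y # w) (Suc i) j) \<longleftrightarrow> (\<forall>i j. ?P (x # y # w) (Suc i) (Suc j))"
    using all_Suc[of "\<lambda>j. ?P (x # y # w) (Suc i) j" for i] by simp
  also have "\<dots> \<longleftrightarrow> (\<forall>i j. ?P (y # w) i j)"
    by simp
  finally show ?case
    using 1 by simp
qed auto

definition continuations ::
    "(nat \<Rightarrow> nat \<Rightarrow> bool) \<Rightarrow> nat \<Rightarrow> nat \<Rightarrow> nat \<Rightarrow> nat list set" where
  "continuations R m l n = {v. length v = n \<and> (\<forall>x\<in>set v. m \<le> x) \<and>
     successively (\<lambda>x y. y \<le> x + 1) (l # v) \<and> respects_floors R (l # v)}"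

lemma continuations_0: "continuations R m l 0 = {[]}"
  by (auto simp: continuations_def)

text \<open>
  A triggering letter \<open>a\<close> is itself at least the old floor \<open>m\<close>, so the new floor \<open>a\<close> replaces the
  old one and a single number suffices to record all the constraints.
\<close>

lemma continuations_Suc:
  "continuations R m l (Suc n) =
     (\<Union>a\<in>{m..l + 1}. (#) a ` continuations R (if R l a then a else m) a n)"
proof (rule set_eqI)
  fix v
  show "v \<in> continuations R m l (Suc n) \<longleftrightarrow>
      v \<in> (\<Union>a\<in>{m..l + 1}. (#) a ` continuations R (if R l a then a else m) a n)"
  proof (cases v)
    case Nil
    then show ?thesis by (auto simp: continuations_def)
  next
    case (Cons a u)
    have "v \<in> continuations R m l (Suc n) \<longleftrightarrow>
        a \<in> {m..l + 1} \<and> u \<in> continuations R (if R l a then a else m) a n"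
      unfolding continuations_def Cons by (auto intro: order_trans)
    then show ?thesis using Cons by auto
  qed
qed

lemma finite_continuations: "finite (continuations R m l n)"
  by (induction n arbitrary: m l) (simp_all add: continuations_0 continuations_Suc)

lemma card_continuations_Suc:
  "card (continuations R m (m + h) (Suc n)) =
     (\<Sum>k\<le>Suc h. card (continuations R (if R (m + h) (m + k) then m + k else m) (m + k) n))"
proof -
  let ?C = "\<lambda>a. continuations R (if R (m + h) a then a else m) a n"
  have "card (continuations R m (m + h) (Suc n)) = (\<Sum>a\<in>{m..m + h + 1}. card ((#) a ` ?C a))"
    unfolding continuations_Suc
    by (rule card_UN_disjoint) (auto simp: finite_continuations)
  also have "\<dots> = (\<Sum>a\<in>{m..m + h + 1}. card (?C a))"
    by (simp add: card_image)
  also have "\<dots> = (\<Sum>k\<le>Suc h. card (?C (m + k)))"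
    by (rule sum.reindex_bij_witness[of _ "\<lambda>k. m + k" "\<lambda>a. a - m"]) auto
  finally show ?thesis .
qed

text \<open>All letters of a Catalan word are at least 1, so the first letter, 1, starts on the floor 1.\<close>

lemma num_avoiders_eq_card_continuations:
  assumes "\<And>a b c. order_isomorphic [a, b, c] [x, y, z] \<longleftrightarrow> R a b \<and> c < b"
  shows "num_avoiders x y z (Suc n) = card (continuations R 1 1 n)"
proof -
  have avoids: "\<not> contains_vincular x y z w \<longleftrightarrow> respects_floors R w" for w
    unfolding contains_vincular_def assms respects_floors_iff_nth by (metis not_less)
  have catalan: "1 # v \<in> catalan_words (Suc n) \<longleftrightarrow>
      length v = n \<and> (\<forall>x\<in>set v. 1 \<le> x) \<and> successively (\<lambda>x y. y \<le> x + 1) (1 # v)" for v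
    unfolding catalan_words_def successively_conv_nth
    by (auto simp: all_set_conv_all_nth less_Suc_eq_0_disj)
  have "\<exists>v. w = 1 # v" if "w \<in> catalan_words (Suc n)" for w
    using that by (cases w) (auto simp: catalan_words_def)
  then have "avoiders x y z (Suc n) = (#) 1 ` continuations R 1 1 n"
    unfolding avoiders_def continuations_def avoids using catalan by fastforce
  then show ?thesis
    by (simp add: num_avoiders_def card_image)
qed

lemma order_isomorphic_221: "order_isomorphic [a, b, c] [2, 2, 1] \<longleftrightarrow> a = b \<and> c < b"
  by (auto simp: order_isomorphic_def less_Suc_eq numeral_3_eq_3)

lemma order_isomorphic_321: "order_isomorphic [a, b, c] [3, 2, 1] \<longleftrightarrow> a > b \<and> c < b"
  by (auto simp: order_isomorphic_def less_Suc_eq)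

section \<open>Motzkin paths that touch the axis\<close>

text \<open>
  \<open>touching n j\<close> is the number of \<open>n\<close>-step Motzkin paths from height \<open>j\<close> whose lowest point is on
  the axis. From height 0 the axis is touched at once, so after an up step any path that
  stays weakly above the axis will do; its lowest point has height 0 or 1, hence the extra
  summand \<open>touching n 0\<close>.
\<close>

fun touching :: "nat \<Rightarrow> nat \<Rightarrow> nat" where
  "touching 0 j = (if j = 0 then 1 else 0)"
| "touching (Suc n) 0 = 2 * touching n 0 + touching n 1"
| "touching (Suc n) (Suc j) = touching n j + touching n (Suc j) + touching n (Suc (Suc j))"

definition motzkin_paths_from :: "int \<Rightarrow> nat \<Rightarrow> (int \<times> int) list set" where
  "motzkin_paths_from h n = {s. set s \<subseteq> {(1, 1), (1, -1), (1, 0)} \<and> length s = n \<and>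
     (\<forall>k\<le>n. h + snd (path_point s k) \<ge> 0)}"

lemma motzkin_paths_from_0: "h \<ge> 0 \<Longrightarrow> motzkin_paths_from h 0 = {[]}"
  by (auto simp: motzkin_paths_from_def path_point_def)

lemma motzkin_paths_from_negative: "h < 0 \<Longrightarrow> motzkin_paths_from h n = {}"
  by (auto simp: motzkin_paths_from_def path_point_def intro: exI[of _ 0])

lemma motzkin_paths_from_Suc:
  assumes "h \<ge> 0"
  shows "motzkin_paths_from h (Suc n) = (\<Union>d\<in>{1, -1, 0}. (#) (1, d) ` motzkin_paths_from (h + d) n)"
proof (rule set_eqI)
  fix s
  show "s \<in> motzkin_paths_from h (Suc n) \<longleftrightarrow>
      s \<in> (\<Union>d\<in>{1, -1, 0}. (#) (1, d) ` motzkin_paths_from (h + d) n)"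
  proof (cases s)
    case Nil
    then show ?thesis by (auto simp: motzkin_paths_from_def)
  next
    case (Cons p t)
    obtain e d where p: "p = (e, d)" by (cases p)
    have split: "(\<forall>k\<le>Suc n. Q k) \<longleftrightarrow> Q 0 \<and> (\<forall>k\<le>n. Q (Suc k))" for Q :: "nat \<Rightarrow> bool"
      by (metis Suc_le_mono not0_implies_Suc zero_le)
    have "s \<in> motzkin_paths_from h (Suc n) \<longleftrightarrow>
        e = 1 \<and> d \<in> {1, -1, 0} \<and> t \<in> motzkin_paths_from (h + d) n"
      unfolding motzkin_paths_from_def path_point_def Cons p mem_Collect_eq split
      using assms by (auto simp: add.assoc)
    then show ?thesis using Cons p by auto
  qed
qed

lemma finite_motzkin_paths_from: "finite (motzkin_paths_from h n)"
proof (rule finite_subset)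
  show "motzkin_paths_from h n \<subseteq> {s. set s \<subseteq> {(1, 1), (1, -1), (1, 0)} \<and> length s = n}"
    by (auto simp: motzkin_paths_from_def)
qed (rule finite_lists_length_eq, simp)

lemma card_motzkin_paths_from_Suc:
  assumes "h \<ge> 0"
  shows "card (motzkin_paths_from h (Suc n)) =
    card (motzkin_paths_from (h + 1) n) + card (motzkin_paths_from (h - 1) n) +
    card (motzkin_paths_from h n)"
proof -
  have "card (motzkin_paths_from h (Suc n)) =
      (\<Sum>d\<in>{1, -1, 0}. card ((#) (1 :: int, d) ` motzkin_paths_from (h + d) n))"
    unfolding motzkin_paths_from_Suc[OF assms]
    by (rule card_UN_disjoint) (auto simp: finite_motzkin_paths_from)
  then show ?thesis by (simp add: card_image)
qed

text \<open>A path from height \<open>h\<close> with lowest point at height \<open>i\<close> touches the axis when shifted down by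
  \<open>i\<close>, and then starts at height \<open>j = h - i\<close>.\<close>

lemma card_motzkin_paths_from:
  "card (motzkin_paths_from (int h) n) = (\<Sum>j\<le>h. touching n j)"
proof (induction n arbitrary: h)
  case 0
  then show ?case by (simp add: motzkin_paths_from_0)
next
  case (Suc n)
  show ?case
  proof (cases h)
    case 0
    then show ?thesis
      using Suc.IH[of 0] Suc.IH[of 1]
      by (simp add: card_motzkin_paths_from_Suc motzkin_paths_from_negative)
  next
    case (Suc i)
    have rec: "(\<Sum>j\<le>Suc i. touching (Suc n) j) =
        (\<Sum>j\<le>Suc (Suc i). touching n j) + (\<Sum>j\<le>i. touching n j) + (\<Sum>j\<le>Suc i. touching n j)"
      by (induction i) simp_all
    have heights: "int h + 1 = int (Suc (Suc i))" "int h - 1 = int i"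
      using Suc by simp_all
    show ?thesis
      unfolding card_motzkin_paths_from_Suc[OF of_nat_0_le_iff] heights Suc.IH
      unfolding Suc rec ..
  qed
qed

lemma L_eq_touching: "L (Suc n) = touching n 0"
proof -
  have "sum_list (map fst s) = int (length s)" if "set s \<subseteq> {(1, 1), (1, -1), (1, 0)}"
    for s :: "(int \<times> int) list"
    using that by (induction s) auto
  then have "motzkin_left_factors (Suc n) = motzkin_paths_from (int 0) n"
    by (auto simp: motzkin_left_factors_def motzkin_paths_from_def path_point_def)
  then show ?thesis
    unfolding L_def using card_motzkin_paths_from[of 0 n] by simp
qed

section \<open>The pattern 22-1\<close>

definition binomial_transform :: "(nat \<Rightarrow> nat) \<Rightarrow> nat \<Rightarrow> nat" where
  "binomial_transform u h = (\<Sum>j\<le>h. (h choose j) * u j)"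

text \<open>The forward difference of a binomial transform is the transform of the shifted sequence, by
  Pascal's rule.\<close>

lemma binomial_transform_Suc:
  "binomial_transform u (Suc h) = binomial_transform u h + binomial_transform (\<lambda>j. u (Suc j)) h"
proof -
  have "binomial_transform u (Suc h) = u 0 + (\<Sum>j\<le>h. (Suc h choose Suc j) * u (Suc j))"
    by (simp add: binomial_transform_def sum.atMost_Suc_shift del: sum.atMost_Suc binomial_Suc_Suc)
  also have "\<dots> = u 0 + (\<Sum>j\<le>h. (h choose Suc j) * u (Suc j)) + (\<Sum>j\<le>h. (h choose j) * u (Suc j))"
    by (simp add: algebra_simps sum.distrib)
  also have "u 0 + (\<Sum>j\<le>h. (h choose Suc j) * u (Suc j)) = (\<Sum>j\<le>Suc h. (h choose j) * u j)"
    by (simp add: sum.atMost_Suc_shift del: sum.atMost_Suc)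
  also have "\<dots> = binomial_transform u h"
    by (simp add: binomial_transform_def)
  finally show ?thesis
    by (simp add: binomial_transform_def)
qed

lemma binomial_transform_add:
  "binomial_transform (\<lambda>j. u j + v j) h = binomial_transform u h + binomial_transform v h"
  by (simp add: binomial_transform_def algebra_simps sum.distrib)

text \<open>
  Both sides agree at \<open>h = 0\<close>, and their forward differences in \<open>h\<close> agree by the three-term
  recurrence for \<open>touching\<close>: shifting the sequence once or twice amounts to differencing
  its transform once or twice.
\<close>

lemma binomial_transform_touching_Suc:
  "binomial_transform (touching (Suc n)) h =
     binomial_transform (touching n) (Suc h) + binomial_transform (touching n) 0 +
     (\<Sum>k<h. binomial_transform (touching n) k)"
proof (induction h)
  case 0
  show ?case by (simp add: binomial_transform_def)
next
  case (Suc h)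
  then show ?case
    by (simp add: binomial_transform_Suc binomial_transform_add del: touching.simps(2))
qed

lemma card_continuations_plateau:
  "card (continuations (=) m (m + h) n) = binomial_transform (touching n) h"
proof (induction n arbitrary: m h)
  case 0
  have "(\<Sum>j\<le>h. (h choose j) * touching 0 j) = (\<Sum>j\<le>h. if j = 0 then 1 else 0)"
    by (rule sum.cong) auto
  then show ?case by (simp add: continuations_0 binomial_transform_def)
next
  case (Suc n)
  have "card (continuations (=) (if m + h = m + k then m + k else m) (m + k) n) =
      binomial_transform (touching n) (if k = h then 0 else k)" for k
    using Suc.IH[of "m + k" 0] Suc.IH[of m k] by auto
  then have "card (continuations (=) m (m + h) (Suc n)) =
      (\<Sum>k\<le>Suc h. binomial_transform (touching n) (if k = h then 0 else k))"
    by (simp only: card_continuations_Suc)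
  also have "\<dots> = binomial_transform (touching n) (Suc h) + binomial_transform (touching n) 0 +
      (\<Sum>k<h. binomial_transform (touching n) k)"
    by (simp add: lessThan_Suc_atMost[symmetric])
  finally show ?case by (simp only: binomial_transform_touching_Suc)
qed

section \<open>The pattern 32-1\<close>

lemma card_continuations_descent:
  "2 * real (card (continuations (>) m (m + h) n)) = (3 ^ n + 1) + (3 ^ n - 1) * real h"
proof (induction n arbitrary: m h)
  case 0
  show ?case by (simp add: continuations_0)
next
  case (Suc n)
  have step: "2 * real (card (continuations (>) (if m + h > m + k then m + k else m) (m + k) n)) =
      (3 ^ n + 1) + (3 ^ n - 1) * real (if k < h then 0 else k)" for k
    using Suc.IH[of "m + k" 0] Suc.IH[of m k] by auto
  have "2 * real (card (continuations (>) m (m + h) (Suc n))) =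
      (\<Sum>k\<le>Suc h. (3 ^ n + 1) + (3 ^ n - 1) * real (if k < h then 0 else k))"
    by (simp only: card_continuations_Suc of_nat_sum sum_distrib_left step)
  also have "\<dots> = (3 ^ Suc n + 1) + (3 ^ Suc n - 1) * real h"
    by (simp add: lessThan_Suc_atMost[symmetric] algebra_simps)
  finally show ?case .
qed

section \<open>The two enumerations\<close>

theorem theorem3p1:
  fixes n :: nat
  assumes "n \<ge> 1"
  shows "num_avoiders 2 2 1 n = L n \<and>
    real (num_avoiders 3 2 1 n) = 1 / 2 * (3 ^ (n - 1) + 1)"
proof -
  obtain p where n: "n = Suc p"
    using assms by (cases n) auto
  have "num_avoiders 2 2 1 n = L n"
    unfolding n num_avoiders_eq_card_continuations[OF order_isomorphic_221] L_eq_touching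
    using card_continuations_plateau[of 1 0 p] by (simp add: binomial_transform_def)
  moreover have "real (num_avoiders 3 2 1 n) = 1 / 2 * (3 ^ (n - 1) + 1)"
    unfolding n num_avoiders_eq_card_continuations[OF order_isomorphic_321]
    using card_continuations_descent[of 1 0 p] by simp
  ultimately show ?thesis ..
qed

end
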